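(* Let $k>0$ be an integer, let $n=\frac{(k+2)(k+1)}{2}$, and let $G=\mathrm{Sym}^k(\mathrm{SL}_3)\leq\mathrm{GL}_n$ be the image of $\mathrm{SL}_3$ under the representation $\mathrm{Sym}^k(\mathbb{C}^3)$ (of dimension $n$). Then the representation $\otimes^3:\mathrm{GL}_n\to\mathrm{GL}((\mathbb{C}^n)^{\otimes 3})$ detects $G$.
   Context: All groups are complex algebraic groups. For a subgroup $G\leq\mathrm{GL}_n$ and a representation $r:\mathrm{GL}_n\to\mathrm{GL}(V_r)$, one says $r$ detects $G$ if $G$ fixes a line in $V_r$ (i.e., $r(G)$ preserves some one-dimensional subspace of $V_r$). *)

theory Defs
  imports "HOL-Analysis.Analysis" "HOL-Library.Poly_Mapping"
begin

text \<open>
  The symmetric algebra of \<open>\<complex>\<^sup>3\<close> is the polynomial ring in the three standard basis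
  vectors \<open>e\<^sub>1, e\<^sub>2, e\<^sub>3\<close>.  A monomial is its exponent vector, of type \<^typ>\<open>3 \<Rightarrow>\<^sub>0 nat\<close>.
  The ring structure is the one of \<^theory>\<open>HOL-Library.Poly_Mapping\<close>.
\<close>

type_synonym poly3 = "(3 \<Rightarrow>\<^sub>0 nat) \<Rightarrow>\<^sub>0 complex"

definition scale_poly :: "complex \<Rightarrow> poly3 \<Rightarrow> poly3" where
  "scale_poly c p = Poly_Mapping.map ((*) c) p"

lemma scale_poly_conv_mult: "scale_poly c p = Poly_Mapping.single 0 c * p"
  by (simp add: scale_poly_def mult_map_scale_conv_mult)

lemma lookup_scale_poly [simp]:
  "Poly_Mapping.lookup (scale_poly c p) m = c * Poly_Mapping.lookup p m"
  by (simp add: scale_poly_def Poly_Mapping.map.rep_eq when_def)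

interpretation poly3: vector_space scale_poly
  by unfold_locales
    (auto intro!: poly_mapping_eqI simp: lookup_add algebra_simps)

definition var :: "3 \<Rightarrow> poly3" where
  "var i = Poly_Mapping.single (Poly_Mapping.single i 1) 1"

definition sym_power :: "nat \<Rightarrow> poly3 set" where
  "sym_power k = {p. \<forall>m \<in> Poly_Mapping.keys p. (\<Sum>i\<in>UNIV. Poly_Mapping.lookup m i) = k}"

text \<open>
  The action of a matrix \<open>A\<close> on the symmetric algebra: the algebra endomorphism extending
  \<open>e\<^sub>j \<mapsto> A e\<^sub>j = (\<Sum>i. A\<^sub>i\<^sub>j e\<^sub>i)\<close>.
\<close>

definition sym_action :: "complex^3^3 \<Rightarrow> poly3 \<Rightarrow> poly3" where
  "sym_action A p =
     (\<Sum>m\<in>Poly_Mapping.keys p. scale_poly (Poly_Mapping.lookup p m)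
        (\<Prod>j\<in>UNIV. (\<Sum>i\<in>UNIV. scale_poly (A $ i $ j) (var i)) ^ Poly_Mapping.lookup m j))"

definition sym_basis :: "nat \<Rightarrow> ('n \<Rightarrow> poly3) \<Rightarrow> bool" where
  "sym_basis k b \<longleftrightarrow>
     inj b \<and> poly3.independent (range b) \<and> poly3.span (range b) = sym_power k"

text \<open>The matrix of the action of \<open>A\<close> with respect to the basis \<open>b\<close>; column \<open>j\<close> holds the
  coordinates of the image of \<open>b j\<close>.\<close>

definition sym_matrix :: "('n::finite \<Rightarrow> poly3) \<Rightarrow> complex^3^3 \<Rightarrow> complex^'n^'n" where
  "sym_matrix b A = (\<chi> i j. poly3.representation (range b) (sym_action A (b j)) (b i))"

definition SL3 :: "(complex^3^3) set" where
  "SL3 = {A. det A = 1}"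

text \<open>\<open>(\<complex>\<^sup>n)\<^sup>\<otimes>\<^sup>3\<close> has the basis \<open>e\<^sub>i \<otimes> e\<^sub>j \<otimes> e\<^sub>l\<close>, indexed by triples.\<close>

definition tensor_cube :: "complex^'n^'n \<Rightarrow> complex^('n \<times> 'n \<times> 'n)^('n::finite \<times> 'n \<times> 'n)" where
  "tensor_cube g = (\<chi> r c. g $ fst r $ fst c
     * g $ fst (snd r) $ fst (snd c) * g $ snd (snd r) $ snd (snd c))"

text \<open>\<open>r\<close> is meant to be a representation of the invertible matrices; its values on singular
  matrices play no role when \<open>G\<close> is a subgroup of \<open>GL\<^sub>n\<close>.\<close>

definition detects ::
    "(complex^'n^'n \<Rightarrow> complex^'m^'m) \<Rightarrow> (complex^'n^'n) set \<Rightarrow> bool" where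
  "detects r G \<longleftrightarrow>
     (\<exists>L. vec.subspace L \<and> vec.dim L = 1 \<and> (\<forall>g\<in>G. (*v) (r g) ` L \<subseteq> L))"

text \<open>
  The definitions above give what they should: \<^const>\<open>tensor_cube\<close> acts on pure tensors by
  \<open>x \<otimes> y \<otimes> z \<mapsto> gx \<otimes> gy \<otimes> gz\<close> and is a representation, \<^const>\<open>sym_action\<close> is an action by
  algebra endomorphisms preserving each \<^term>\<open>sym_power k\<close>, whose dimension is
  \<open>(k + 2)(k + 1) / 2\<close> (so bases exist), and \<^term>\<open>sym_matrix b\<close> is a representation by
  invertible matrices.
\<close>

lemma sum_triples:
  fixes f :: "'n::finite \<Rightarrow> complex"
  shows "(\<Sum>c\<in>UNIV. f (fst c) * g (fst (snd c)) * h (snd (snd c))) = sum f UNIV * sum g UNIV * sum h UNIV"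
proof -
  have "(\<Sum>c\<in>UNIV. f (fst c) * g (fst (snd c)) * h (snd (snd c))) =
      (\<Sum>(i, j, l)\<in>UNIV \<times> UNIV \<times> UNIV. f i * g j * h l)"
    by (simp add: case_prod_unfold)
  also have "\<dots> = (\<Sum>i\<in>UNIV. \<Sum>j\<in>UNIV. \<Sum>l\<in>UNIV. f i * g j * h l)"
    by (simp only: sum.cartesian_product)
  also have "\<dots> = sum f UNIV * sum g UNIV * sum h UNIV"
    by (simp add: sum_distrib_left[symmetric] sum_distrib_right[symmetric])
  finally show ?thesis .
qed

lemma tensor_cube_pure:
  "tensor_cube g *v (\<chi> c. x $ fst c * y $ fst (snd c) * z $ snd (snd c)) =
     (\<chi> r. (g *v x) $ fst r * (g *v y) $ fst (snd r) * (g *v z) $ snd (snd r))"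
  unfolding vec_eq_iff matrix_vector_mult_def
  by (simp add: tensor_cube_def sum_triples[symmetric], simp add: mult_ac)

lemma tensor_cube_mult: "tensor_cube (A ** B) = tensor_cube A ** tensor_cube B"
  unfolding vec_eq_iff matrix_matrix_mult_def
  by (simp add: tensor_cube_def sum_triples[symmetric], simp add: mult_ac)

lemma tensor_cube_one: "tensor_cube (mat 1) = mat 1"
  by (auto simp: vec_eq_iff tensor_cube_def mat_def)

lemma poly3_sum_monomials:
  fixes p :: poly3
  shows "p = (\<Sum>m\<in>Poly_Mapping.keys p. scale_poly (Poly_Mapping.lookup p m) (Poly_Mapping.single m 1))"
proof (rule poly_mapping_eqI)
  fix x
  have "(\<Sum>m\<in>Poly_Mapping.keys p. Poly_Mapping.lookup p m * (1 when m = x)) =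
     (\<Sum>m\<in>Poly_Mapping.keys p. if m = x then Poly_Mapping.lookup p m else 0)"
    by (rule sum.cong) auto
  then show "Poly_Mapping.lookup p x = Poly_Mapping.lookup (\<Sum>m\<in>Poly_Mapping.keys p. scale_poly (Poly_Mapping.lookup p m) (Poly_Mapping.single m 1)) x"
    by (simp add: lookup_sum lookup_single in_keys_iff)
qed

definition mon_action :: "complex^3^3 \<Rightarrow> (3 \<Rightarrow>\<^sub>0 nat) \<Rightarrow> poly3" where
  "mon_action A m = (\<Prod>j\<in>UNIV. (\<Sum>i\<in>UNIV. scale_poly (A $ i $ j) (var i)) ^ Poly_Mapping.lookup m j)"

lemma sym_action_superset:
  assumes "finite S" "Poly_Mapping.keys p \<subseteq> S"
  shows "sym_action A p = (\<Sum>m\<in>S. scale_poly (Poly_Mapping.lookup p m) (mon_action A m))"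
  unfolding sym_action_def mon_action_def[symmetric]
  using assms by (intro sum.mono_neutral_left) (auto simp: in_keys_iff)

lemma sym_action_add: "sym_action A (p + q) = sym_action A p + sym_action A q"
proof -
  let ?S = "Poly_Mapping.keys p \<union> Poly_Mapping.keys q"
  show ?thesis
    using keys_add[of p q]
    by (simp add: sym_action_superset[of ?S] lookup_add poly3.scale_left_distrib sum.distrib)
qed

lemma sym_action_scale: "sym_action A (scale_poly c p) = scale_poly c (sym_action A p)"
proof -
  have "Poly_Mapping.keys (scale_poly c p) \<subseteq> Poly_Mapping.keys p"
    by (auto simp: in_keys_iff)
  then show ?thesis
    by (simp add: sym_action_superset[of "Poly_Mapping.keys p"] poly3.scale_sum_right)
qed

interpretation sym_action: Vector_Spaces.linear scale_poly scale_poly "sym_action A" for A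
  by unfold_locales (simp_all add: sym_action_add sym_action_scale)

lemma sym_action_single: "sym_action A (Poly_Mapping.single m 1) = mon_action A m"
  by (simp add: sym_action_superset[of "{m}"])

lemma mon_action_add: "mon_action A (m + n) = mon_action A m * mon_action A n"
  by (simp add: mon_action_def lookup_add power_add prod.distrib)

lemma scale_poly_mult: "scale_poly c p * q = scale_poly c (p * q)"
  "p * scale_poly c q = scale_poly c (p * q)"
  by (simp_all add: scale_poly_conv_mult mult_ac)

lemma sym_action_mult: "sym_action A (p * q) = sym_action A p * sym_action A q"
proof -
  have *: "sym_action A (Poly_Mapping.single m 1 * Poly_Mapping.single n 1) = mon_action A m * mon_action A n" for m n
    by (simp only: mult_single sym_action_single mon_action_add mult_1)
  have p: "sym_action A p = (\<Sum>m\<in>Poly_Mapping.keys p. scale_poly (Poly_Mapping.lookup p m) (mon_action A m))" for p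
    by (simp add: sym_action_superset)
  show ?thesis
    apply (subst (1) poly3_sum_monomials[of p])
    apply (subst (1) poly3_sum_monomials[of q])
    apply (simp only: sum_product scale_poly_mult sym_action.sum sym_action.scale * )
    apply (simp only: p[of p] p[of q] sum_product scale_poly_mult)
    done
qed

lemma sym_action_one: "sym_action A 1 = 1"
  using sym_action_single[of A 0] by (simp add: mon_action_def)

lemma sym_action_prod: "sym_action A (prod f S) = (\<Prod>x\<in>S. sym_action A (f x))"
  by (induction S rule: infinite_finite_induct) (simp_all add: sym_action_one sym_action_mult)

lemma sym_action_power: "sym_action A (p ^ n) = sym_action A p ^ n"
  by (induction n) (simp_all add: sym_action_one sym_action_mult)

lemma sym_action_var: "sym_action A (var j) = (\<Sum>i\<in>UNIV. scale_poly (A $ i $ j) (var i))"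
proof -
  have "(\<Prod>l\<in>UNIV. f l ^ (1 when j = l)) = f j" for f :: "3 \<Rightarrow> poly3"
  proof -
    have "(\<Prod>l\<in>UNIV. f l ^ (1 when j = l)) = (\<Prod>l\<in>UNIV. if l = j then f l else 1)"
      by (rule prod.cong) auto
    then show ?thesis by simp
  qed
  then show ?thesis
    by (simp add: var_def sym_action_single mon_action_def lookup_single)
qed

lemma sym_action_comp: "sym_action (A ** B) p = sym_action A (sym_action B p)"
proof -
  have v: "sym_action (A ** B) (var j) = sym_action A (sym_action B (var j))" for j
    by (simp add: sym_action_var sym_action.sum sym_action.scale matrix_matrix_mult_def
        poly3.scale_sum_left poly3.scale_sum_right mult.commute)
       (rule sum.swap)
  have m: "mon_action (A ** B) m = sym_action A (mon_action B m)" for m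
    unfolding mon_action_def sym_action_prod sym_action_power
    using v by (simp add: sym_action_var)
  show ?thesis
    by (simp add: sym_action_superset[of "Poly_Mapping.keys p" p] m sym_action.sum sym_action.scale)
qed

lemma var_power: "var i ^ n = Poly_Mapping.single (Poly_Mapping.single i n) 1"
  by (induction n) (simp_all add: var_def mult_single single_add[symmetric])

lemma mon_action_id: "mon_action (mat 1) m = Poly_Mapping.single m 1"
proof -
  have 1: "(\<Sum>i\<in>UNIV. scale_poly ((mat 1 :: complex^3^3) $ i $ j) (var i)) = var j" for j
  proof -
    have "(\<Sum>i\<in>UNIV. scale_poly ((mat 1 :: complex^3^3) $ i $ j) (var i)) = (\<Sum>i\<in>UNIV. if i = j then var i else 0)"
      by (rule sum.cong) (auto simp: mat_def)
    then show ?thesis by simp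
  qed
  have s: "(\<Prod>j\<in>S. Poly_Mapping.single (f j) (1::complex)) = Poly_Mapping.single (sum f S) 1" 
    for f :: "3 \<Rightarrow> (3 \<Rightarrow>\<^sub>0 nat)" and S
    by (induction S rule: infinite_finite_induct) (simp_all add: mult_single)
  have "(\<Sum>j\<in>UNIV. Poly_Mapping.single j (Poly_Mapping.lookup m j)) = m"
    by (rule poly_mapping_eqI) (simp add: lookup_sum lookup_single when_def)
  then show ?thesis
    by (simp add: mon_action_def 1 var_power s)
qed

lemma sym_action_id: "sym_action (mat 1) p = p"
  by (simp add: sym_action_superset[of "Poly_Mapping.keys p"] mon_action_id poly3_sum_monomials[symmetric])

lemma sym_power_eq_span:
  "sym_power k = poly3.span ((\<lambda>m. Poly_Mapping.single m 1) ` {m. (\<Sum>i\<in>UNIV. Poly_Mapping.lookup m i) = k})"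
  (is "_ = poly3.span ?B")
proof
  show "sym_power k \<subseteq> poly3.span ?B"
  proof
    fix p assume "p \<in> sym_power k"
    then have "(\<Sum>m\<in>Poly_Mapping.keys p. scale_poly (Poly_Mapping.lookup p m) (Poly_Mapping.single m 1)) \<in> poly3.span ?B"
      by (intro poly3.span_sum poly3.span_scale poly3.span_base) (auto simp: sym_power_def)
    then show "p \<in> poly3.span ?B"
      using poly3_sum_monomials[of p] by simp
  qed
  have "poly3.subspace (sym_power k)"
  proof (rule poly3.subspaceI)
    fix p q assume "p \<in> sym_power k" "q \<in> sym_power k"
    then show "p + q \<in> sym_power k"
      using keys_add[of p q] unfolding sym_power_def by blast
  qed (auto simp: sym_power_def in_keys_iff)
  then show "poly3.span ?B \<subseteq> sym_power k"
    by (intro poly3.span_minimal) (auto simp: sym_power_def)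
qed

lemma sym_power_mult:
  assumes "p \<in> sym_power k" "q \<in> sym_power l"
  shows "p * q \<in> sym_power (k + l)"
  using assms keys_mult[of p q] by (fastforce simp: sym_power_def lookup_add sum.distrib)

lemma subspace_sym_power: "poly3.subspace (sym_power k)"
  by (simp add: sym_power_eq_span)

lemma one_in_sym_power: "1 \<in> sym_power 0"
  by (simp add: sym_power_def)

lemma sym_power_power: "p \<in> sym_power k \<Longrightarrow> p ^ n \<in> sym_power (n * k)"
  by (induction n) (simp_all add: one_in_sym_power sym_power_mult)

lemma sym_power_prod:
  "(\<And>x. x \<in> S \<Longrightarrow> f x \<in> sym_power (d x)) \<Longrightarrow> prod f S \<in> sym_power (sum d S)"
  by (induction S rule: infinite_finite_induct) (simp_all add: one_in_sym_power sym_power_mult)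

lemma var_in_sym_power: "var i \<in> sym_power 1"
  by (auto simp: var_def sym_power_def lookup_single when_def)

lemma sym_action_in_sym_power:
  assumes "p \<in> sym_power k"
  shows "sym_action A p \<in> sym_power k"
proof -
  have "(\<Sum>i\<in>UNIV. scale_poly (A $ i $ j) (var i)) \<in> sym_power 1" for j
    by (intro poly3.subspace_sum poly3.subspace_scale subspace_sym_power var_in_sym_power)
  then have "mon_action A m \<in> sym_power (\<Sum>j\<in>UNIV. Poly_Mapping.lookup m j)" for m
    unfolding mon_action_def
    by (intro sym_power_prod) (use sym_power_power[where k=1] in simp)
  with assms show ?thesis
    unfolding sym_action_superset[OF finite_keys order_refl]
    by (intro poly3.subspace_sum poly3.subspace_scale subspace_sym_power)
       (auto simp: sym_power_def)
qed

lemma inj_single1: "Poly_Mapping.single m (1::complex) = Poly_Mapping.single m' 1 \<longleftrightarrow> m = m'"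
  by (metis keys_single singleton_inject zero_neq_one)

lemma independent_monomials: "poly3.independent ((\<lambda>m. Poly_Mapping.single m 1) ` M)"
proof
  assume "poly3.dependent ((\<lambda>m. Poly_Mapping.single m 1) ` M)"
  then obtain S u v where S: "finite S" "S \<subseteq> (\<lambda>m. Poly_Mapping.single m 1) ` M" "v \<in> S" "u v \<noteq> 0"
    and z: "(\<Sum>v\<in>S. scale_poly (u v) v) = 0"
    unfolding poly3.dependent_explicit by blast
  obtain m where m: "v = Poly_Mapping.single m 1" using S by blast
  have "0 = Poly_Mapping.lookup (\<Sum>v\<in>S. scale_poly (u v) v) m" by (simp add: z)
  also have "\<dots> = (\<Sum>w\<in>S. u w * Poly_Mapping.lookup w m)" by (simp add: lookup_sum)
  also have "\<dots> = (\<Sum>w\<in>S. if w = v then u w else 0)"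
  proof (rule sum.cong)
    fix w assume "w \<in> S"
    then obtain m' where m': "w = Poly_Mapping.single m' 1" using S by blast
    show "u w * Poly_Mapping.lookup w m = (if w = v then u w else 0)"
      unfolding m m' by (cases "m' = m") (simp_all add: lookup_single inj_single1)
  qed simp
  also have "\<dots> = u v" using S by simp
  finally show False using S by simp
qed

lemma card_monomials: "card {m :: 3 \<Rightarrow>\<^sub>0 nat. (\<Sum>i\<in>UNIV. Poly_Mapping.lookup m i) = k} = (k + 2) * (k + 1) div 2"
proof -
  define f where "f m = [Poly_Mapping.lookup m (1::3), Poly_Mapping.lookup m 2, Poly_Mapping.lookup m 3]" for m :: "3 \<Rightarrow>\<^sub>0 nat"
  have "bij_betw f {m. (\<Sum>i\<in>UNIV. Poly_Mapping.lookup m i) = k} {l. length l = 3 \<and> sum_list l = k}"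
  proof (rule bij_betw_imageI)
    show "inj_on f {m. (\<Sum>i\<in>UNIV. Poly_Mapping.lookup m i) = k}"
    proof (rule inj_onI)
      fix x y assume "f x = f y"
      then have "\<forall>i::3. Poly_Mapping.lookup x i = Poly_Mapping.lookup y i"
        unfolding forall_3 by (simp add: f_def)
      then show "x = y" by (intro poly_mapping_eqI) auto
    qed
    show "f ` {m. (\<Sum>i\<in>UNIV. Poly_Mapping.lookup m i) = k} = {l. length l = 3 \<and> sum_list l = k}"
    proof (intro equalityI subsetI)
      fix l assume l: "l \<in> {l. length l = 3 \<and> sum_list l = k}"
      then obtain a b c where abc: "l = [a, b, c]"
        by (auto simp: numeral_3_eq_3 length_Suc_conv)
      define m where "m = Poly_Mapping.single (1::3) a + Poly_Mapping.single 2 b + Poly_Mapping.single 3 c"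
      have "f m = l"
        by (simp add: abc f_def m_def lookup_add lookup_single)
      moreover have "(\<Sum>i\<in>UNIV. Poly_Mapping.lookup m i) = k"
        using l by (simp add: m_def abc sum_3 lookup_add lookup_single)
      ultimately show "l \<in> f ` {m. (\<Sum>i\<in>UNIV. Poly_Mapping.lookup m i) = k}" by blast
    qed (auto simp: f_def sum_3)
  qed
  then have "card {m :: 3 \<Rightarrow>\<^sub>0 nat. (\<Sum>i\<in>UNIV. Poly_Mapping.lookup m i) = k} = (k + 2) choose k"
    by (simp add: bij_betw_same_card card_length_sum_list)
  also have "\<dots> = (k + 2) choose 2"
    by (subst binomial_symmetric) auto
  finally show ?thesis by (simp add: choose_two)
qed

lemma dim_sym_power: "poly3.dim (sym_power k) = (k + 2) * (k + 1) div 2"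
proof -
  have "inj_on (\<lambda>m :: 3 \<Rightarrow>\<^sub>0 nat. Poly_Mapping.single m (1::complex)) M" for M
    by (rule inj_onI) (metis keys_single singleton_inject zero_neq_one)
  then show ?thesis
    unfolding sym_power_eq_span poly3.dim_span
    by (simp add: poly3.dim_eq_card_independent[OF independent_monomials] card_image card_monomials)
qed

lemma ex_sym_basis:
  assumes "CARD('n::finite) = (k + 2) * (k + 1) div 2"
  shows "\<exists>b :: 'n \<Rightarrow> poly3. sym_basis k b"
proof -
  let ?M = "{m :: 3 \<Rightarrow>\<^sub>0 nat. (\<Sum>i\<in>UNIV. Poly_Mapping.lookup m i) = k}"
  have c: "card ?M = CARD('n)" using assms by (simp add: card_monomials)
  then have "finite ?M" by (metis card.infinite finite_UNIV_card_ge_0 finite_code less_irrefl)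
  then obtain e :: "'n \<Rightarrow> _" where e: "bij_betw e UNIV ?M"
    using c finite_same_card_bij[of "UNIV :: 'n set" ?M] by auto
  let ?b = "\<lambda>i. Poly_Mapping.single (e i) (1::complex)"
  have "inj ?b"
    by (rule injI) (metis bij_betw_imp_inj_on[OF e] injD keys_single singleton_inject zero_neq_one)
  moreover have "range ?b = (\<lambda>m. Poly_Mapping.single m 1) ` ?M"
    unfolding bij_betw_imp_surj_on[OF e, symmetric] image_image ..
  ultimately show ?thesis
    unfolding sym_basis_def using independent_monomials sym_power_eq_span by metis
qed

lemma sym_action_basis:
  assumes "sym_basis k b"
  shows "sym_action A (b j) = (\<Sum>i\<in>UNIV. scale_poly (sym_matrix b A $ i $ j) (b i))"
proof -
  have "b j \<in> sym_power k"
    using assms poly3.span_base[of "b j" "range b"] by (auto simp: sym_basis_def)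
  then have "sym_action A (b j) \<in> poly3.span (range b)"
    using assms sym_action_in_sym_power by (simp add: sym_basis_def)
  then have "sym_action A (b j) = (\<Sum>v\<in>range b. scale_poly (poly3.representation (range b) (sym_action A (b j)) v) v)"
    using assms by (subst poly3.sum_representation_eq) (auto simp: sym_basis_def)
  also have "\<dots> = (\<Sum>i\<in>UNIV. scale_poly (sym_matrix b A $ i $ j) (b i))"
    using assms by (subst sum.reindex) (auto simp: sym_basis_def sym_matrix_def)
  finally show ?thesis .
qed

lemma sym_matrix_eqI:
  assumes "sym_basis k b" "\<And>j. sym_action A (b j) = (\<Sum>i\<in>UNIV. scale_poly (M $ i $ j) (b i))"
  shows "sym_matrix b A = M"
proof -
  have "sym_matrix b A $ i $ j = M $ i $ j" for i j
  proof -
    have ind: "poly3.independent (range b)"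
      using assms(1) by (simp add: sym_basis_def)
    have span: "b l \<in> poly3.span (range b)" for l
      by (simp add: poly3.span_base)
    have "poly3.representation (range b) (\<Sum>l\<in>UNIV. scale_poly (M $ l $ j) (b l)) (b i) =
        (\<Sum>l\<in>UNIV. poly3.representation (range b) (scale_poly (M $ l $ j) (b l)) (b i))"
      by (subst poly3.representation_sum[OF ind]) (simp_all add: span poly3.span_scale)
    also have "\<dots> = (\<Sum>l\<in>UNIV. M $ l $ j * (if b i = b l then 1 else 0))"
      by (simp only: poly3.representation_scale[OF ind span] poly3.representation_basis[OF ind rangeI])
    also have "\<dots> = (\<Sum>l\<in>UNIV. if l = i then M $ l $ j else 0)"
      using assms(1) by (intro sum.cong) (auto simp: sym_basis_def inj_eq)
    finally show ?thesis using assms(2) by (simp add: sym_matrix_def)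
  qed
  then show ?thesis by (simp add: vec_eq_iff)
qed

lemma sym_matrix_mult:
  assumes "sym_basis k b"
  shows "sym_matrix b (A ** B) = sym_matrix b A ** sym_matrix b B"
proof (rule sym_matrix_eqI[OF assms])
  fix j
  have "sym_action (A ** B) (b j) = (\<Sum>l\<in>UNIV. \<Sum>i\<in>UNIV.
      scale_poly (sym_matrix b A $ i $ l * sym_matrix b B $ l $ j) (b i))"
    by (simp add: sym_action_comp sym_action_basis[OF assms, of B] sym_action.sum sym_action.scale
        sym_action_basis[OF assms, of A] poly3.scale_sum_right mult.commute)
  also have "\<dots> = (\<Sum>i\<in>UNIV. scale_poly ((sym_matrix b A ** sym_matrix b B) $ i $ j) (b i))"
    by (subst sum.swap) (simp add: matrix_matrix_mult_def poly3.scale_sum_left)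
  finally show "sym_action (A ** B) (b j) =
      (\<Sum>i\<in>UNIV. scale_poly ((sym_matrix b A ** sym_matrix b B) $ i $ j) (b i))" .
qed

lemma sym_matrix_one:
  assumes "sym_basis k b"
  shows "sym_matrix b (mat 1) = mat 1"
proof (rule sym_matrix_eqI[OF assms])
  fix j
  have "(\<Sum>i\<in>UNIV. scale_poly (mat 1 $ i $ j) (b i)) = (\<Sum>i\<in>UNIV. if i = j then b i else 0)"
    by (rule sum.cong) (auto simp: mat_def)
  then show "sym_action (mat 1) (b j) = (\<Sum>i\<in>UNIV. scale_poly (mat 1 $ i $ j) (b i))"
    by (simp add: sym_action_id)
qed

lemma invertible_sym_matrix:
  assumes "sym_basis k b" "invertible A"
  shows "invertible (sym_matrix b A)"
  using assms unfolding invertible_def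
  by (metis sym_matrix_mult sym_matrix_one)

lemma invertible_tensor_cube:
  assumes "invertible A"
  shows "invertible (tensor_cube A)"
  using assms unfolding invertible_def
  by (metis tensor_cube_mult tensor_cube_one)

lemma sym_matrix_SL3_subset_GL:
  assumes "sym_basis k b"
  shows "sym_matrix b ` SL3 \<subseteq> {g. invertible g}"
  using invertible_sym_matrix[OF assms] by (auto simp: SL3_def invertible_det_nz)

end

theory Submission
  imports Defs
begin

text \<open>
  In \<open>S \<otimes> S \<otimes> S\<close>, where \<open>S\<close> is the symmetric algebra of \<open>\<complex>\<^sup>3\<close>, the alternating tensor
  \<open>D = (\<Sum>\<sigma>. sgn \<sigma> e\<^bsub>\<sigma>1\<^esub> \<otimes> e\<^bsub>\<sigma>2\<^esub> \<otimes> e\<^bsub>\<sigma>3\<^esub>)\<close> satisfies \<open>A D = det A D\<close>.  As \<open>A\<close> acts by algebra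
  endomorphisms, \<open>D ^ k\<close> is an \<open>SL\<^sub>3\<close>-invariant of \<open>Sym\<^sup>k \<otimes> Sym\<^sup>k \<otimes> Sym\<^sup>k\<close>.  It spans an invariant
  line, because its coefficient at \<open>e\<^sub>1\<^sup>k \<otimes> e\<^sub>2\<^sup>k \<otimes> e\<^sub>3\<^sup>k\<close> is 1.
\<close>

abbreviation functional :: "(poly3 \<Rightarrow> complex) \<Rightarrow> bool" where
  "functional \<equiv> Vector_Spaces.linear scale_poly (*)"

text \<open>This is the value at \<open>D\<close> of the trilinear form with coefficients
  \<open>t\<close>: the signed sum over the six permutations of 1, 2, 3.\<close>

definition alternation :: "(3 \<Rightarrow> 3 \<Rightarrow> 3 \<Rightarrow> complex) \<Rightarrow> complex" where
  "alternation t = t 1 2 3 - t 1 3 2 + t 2 3 1 - t 2 1 3 + t 3 1 2 - t 3 2 1"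

lemma alternation_cong:
  "(\<And>a b c. t a b c = u a b c) \<Longrightarrow> alternation t = alternation u"
  by (simp add: alternation_def)

lemma alternation_scale: "alternation (\<lambda>a b c. x * t a b c) = x * alternation t"
  by (simp add: alternation_def algebra_simps)

lemma alternation_sum:
  "alternation (\<lambda>a b c. \<Sum>i\<in>I. t i a b c) = (\<Sum>i\<in>I. alternation (t i))"
  by (simp add: alternation_def sum.distrib sum_subtractf)

text \<open>Coordinate form of \<open>A D = det A D\<close>. Both sides are linear in
  \<open>t\<close>, so indicators of single triples suffice; for these the left side is the Leibniz
  expansion of the determinant formed from rows \<open>i\<close>, \<open>j\<close>, \<open>l\<close>
  of \<open>A\<close>.\<close>

lemma alternation_matrix:
  "alternation (\<lambda>a b c. \<Sum>i\<in>UNIV. \<Sum>j\<in>UNIV. \<Sum>l\<in>UNIV. A $ i $ a * A $ j $ b * A $ l $ c * t i j l) =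
     det A * alternation t"
proof -
  \<comment> \<open>\<open>e\<close> is the Levi-Civita symbol.\<close>
  define e where "e i j l = alternation (\<lambda>a b c. of_bool (a = i \<and> b = j \<and> c = l))" for i j l
  have "\<forall>i j l. alternation (\<lambda>a b c. A $ i $ a * A $ j $ b * A $ l $ c) = det A * e i j l"
    unfolding forall_3 e_def alternation_def det_3 by (simp add: mult_ac)
  moreover have "alternation t = (\<Sum>i\<in>UNIV. \<Sum>j\<in>UNIV. \<Sum>l\<in>UNIV. t i j l * e i j l)"
    unfolding sum_3 e_def alternation_def by simp
  ultimately show ?thesis
    by (subst mult.commute[of _ "t _ _ _"])
       (simp add: alternation_sum alternation_scale sum_distrib_left mult_ac)
qed

text \<open>The value of \<open>f \<otimes> g \<otimes> h\<close> at \<open>D ^ k\<close>, without constructing the tensor product.\<close>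

fun det_power_pairing ::
    "nat \<Rightarrow> (poly3 \<Rightarrow> complex) \<Rightarrow> (poly3 \<Rightarrow> complex) \<Rightarrow> (poly3 \<Rightarrow> complex) \<Rightarrow> complex" where
  "det_power_pairing 0 f g h = f 1 * g 1 * h 1"
| "det_power_pairing (Suc k) f g h = alternation (\<lambda>a b c.
     det_power_pairing k (\<lambda>p. f (var a * p)) (\<lambda>p. g (var b * p)) (\<lambda>p. h (var c * p)))"

text \<open>Trilinearity passes through the recursion, since precomposing with multiplication by a
  variable commutes with linear combinations of functions.\<close>

lemma det_power_pairing_sum:
  "det_power_pairing k (\<lambda>p. \<Sum>i\<in>I. x i * f i p) (\<lambda>p. \<Sum>j\<in>J. y j * g j p) (\<lambda>p. \<Sum>l\<in>L. z l * h l p) =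
     (\<Sum>i\<in>I. \<Sum>j\<in>J. \<Sum>l\<in>L. x i * y j * z l * det_power_pairing k (f i) (g j) (h l))"
proof (induction k arbitrary: f g h)
  case 0
  show ?case
    by (simp add: sum_distrib_left sum_distrib_right mult_ac) (rule sum.swap)
next
  case (Suc k)
  show ?case
    by (simp only: det_power_pairing.simps Suc alternation_sum alternation_scale)
qed

text \<open>\<open>D ^ k\<close> has degree \<open>k\<close> in each tensor factor. Expansions valid
  only on \<open>sym_power k\<close> can therefore be substituted into the pairing.\<close>

lemma det_power_pairing_cong:
  assumes "\<And>p. p \<in> sym_power k \<Longrightarrow> f p = f' p" "\<And>p. p \<in> sym_power k \<Longrightarrow> g p = g' p"
    "\<And>p. p \<in> sym_power k \<Longrightarrow> h p = h' p"
  shows "det_power_pairing k f g h = det_power_pairing k f' g' h'"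
  using assms
proof (induction k arbitrary: f g h f' g' h')
  case 0
  then show ?case by (simp add: one_in_sym_power)
next
  case (Suc k)
  have "var a * p \<in> sym_power (Suc k)" if "p \<in> sym_power k" for a p
    using sym_power_mult[OF var_in_sym_power that] by simp
  then show ?case
    unfolding det_power_pairing.simps
    by (intro alternation_cong Suc.IH Suc.prems)
qed

lemma functional_mult:
  assumes "functional f"
  shows "functional (\<lambda>p. f (q * p))"
proof -
  interpret f: Vector_Spaces.linear scale_poly "(*)" f by fact
  show ?thesis
    by unfold_locales (simp_all add: distrib_left scale_poly_mult f.add f.scale)
qed

text \<open>Since \<open>A\<close> acts multiplicatively, one factor \<open>D\<close> splits off at
  each step and contributes one factor \<open>det A\<close>.\<close>

lemma det_power_pairing_sym_action:
  assumes "functional f" "functional g" "functional h"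
  shows "det_power_pairing k (\<lambda>p. f (sym_action A p)) (\<lambda>p. g (sym_action A p)) (\<lambda>p. h (sym_action A p)) =
     det A ^ k * det_power_pairing k f g h"
  using assms
proof (induction k arbitrary: f g h)
  case 0
  show ?case by (simp add: sym_action_one)
next
  case (Suc k)
  have expand: "(\<lambda>p. f (sym_action A (var a) * p)) = (\<lambda>p. \<Sum>i\<in>UNIV. A $ i $ a * f (var i * p))"
    if "functional f" for f a
  proof -
    interpret f: Vector_Spaces.linear scale_poly "(*)" f by fact
    show ?thesis
      by (simp add: sym_action_var sum_distrib_right scale_poly_mult f.sum f.scale)
  qed
  let ?D = "\<lambda>i j l. det_power_pairing k (\<lambda>p. f (var i * p)) (\<lambda>p. g (var j * p)) (\<lambda>p. h (var l * p))"
  \<comment> \<open>The induction hypothesis is used for functionals such as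
    \<open>\<lambda>p. f (sym_action A (var a) * p)\<close>, which are again linear.\<close>
  have "det_power_pairing k (\<lambda>p. f (sym_action A (var a * p))) (\<lambda>p. g (sym_action A (var b * p)))
      (\<lambda>p. h (sym_action A (var c * p))) =
      det A ^ k * (\<Sum>i\<in>UNIV. \<Sum>j\<in>UNIV. \<Sum>l\<in>UNIV. A $ i $ a * A $ j $ b * A $ l $ c * ?D i j l)" for a b c
    unfolding sym_action_mult
    by (simp only: Suc.IH[OF functional_mult functional_mult functional_mult, OF Suc.prems]
        expand[OF Suc.prems(1)] expand[OF Suc.prems(2)] expand[OF Suc.prems(3)] det_power_pairing_sum)
  then show ?case
    by (simp only: det_power_pairing.simps alternation_scale alternation_matrix) simp
qed

text \<open>A variable divides a positive power of the variable \<open>var i\<close> only if it is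
  \<open>var i\<close> itself.\<close>

lemma lookup_var_mult:
  "Poly_Mapping.lookup (var a * p) (Poly_Mapping.single i (Suc k)) =
     (if a = i then Poly_Mapping.lookup p (Poly_Mapping.single i k) else 0)"
proof -
  have eq: "Poly_Mapping.single a 1 + m = Poly_Mapping.single i (Suc k) \<longleftrightarrow>
      a = i \<and> m = Poly_Mapping.single i k" for m
  proof
    assume *: "Poly_Mapping.single a 1 + m = Poly_Mapping.single i (Suc k)"
    have "1 + Poly_Mapping.lookup m a = Poly_Mapping.lookup (Poly_Mapping.single i (Suc k)) a"
      unfolding *[symmetric] by (simp add: lookup_add)
    then have "a = i" by (auto simp: lookup_single when_def split: if_splits)
    moreover have "Poly_Mapping.single i (Suc k) = Poly_Mapping.single i 1 + Poly_Mapping.single i k"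
      by (simp add: single_add[symmetric])
    ultimately show "a = i \<and> m = Poly_Mapping.single i k" using * by simp
  qed (simp add: single_add[symmetric])
  have "var a * p = (\<Sum>m\<in>Poly_Mapping.keys p.
      scale_poly (Poly_Mapping.lookup p m) (Poly_Mapping.single (Poly_Mapping.single a 1 + m) 1))"
    by (subst (1) poly3_sum_monomials[of p])
       (simp add: sum_distrib_left scale_poly_mult var_def mult_single)
  then show ?thesis
    using eq by (simp add: lookup_sum lookup_single when_def if_distrib[of "(*) _"] in_keys_iff cong: if_cong)
qed

lemma det_power_pairing_zero: "det_power_pairing k (\<lambda>p. 0) g h = 0"
  "det_power_pairing k f (\<lambda>p. 0) h = 0" "det_power_pairing k f g (\<lambda>p. 0) = 0"
  by (induction k arbitrary: f g h) (simp_all add: alternation_def)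

text \<open>Only the identity permutation survives in each alternation: any other one puts a wrong
  variable into some slot, and that coefficient functional becomes zero.\<close>

lemma det_power_pairing_leading_coeff:
  "det_power_pairing k (\<lambda>p. Poly_Mapping.lookup p (Poly_Mapping.single 1 k))
     (\<lambda>p. Poly_Mapping.lookup p (Poly_Mapping.single 2 k))
     (\<lambda>p. Poly_Mapping.lookup p (Poly_Mapping.single 3 k)) = 1"
  by (induction k)
     (simp_all add: alternation_def lookup_var_mult det_power_pairing_zero)

text \<open>The coordinate functionals are extended from \<open>sym_power k\<close> to the whole
  polynomial ring, because \<open>functional\<close> asks for linearity there.\<close>

lemma sym_basis_dual:
  fixes b :: "'n::finite \<Rightarrow> poly3"
  assumes "sym_basis k b"
  obtains \<phi> where "\<And>i. functional (\<phi> i)"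
    "\<And>p. p \<in> sym_power k \<Longrightarrow> p = (\<Sum>i\<in>UNIV. scale_poly (\<phi> i p) (b i))"
    "\<And>i j. \<phi> i (b j) = (if i = j then 1 else 0)"
proof -
  interpret vector_space_pair scale_poly "(*) :: complex \<Rightarrow> complex \<Rightarrow> complex"
    by unfold_locales (simp_all add: algebra_simps)
  have b: "inj b" "poly3.independent (range b)" "poly3.span (range b) = sym_power k"
    using assms by (auto simp: sym_basis_def)
  have "\<exists>f. functional f \<and> (\<forall>j. f (b j) = (if i = j then 1 else 0))" for i
    using linear_independent_extend[OF b(2), of "\<lambda>v. if v = b i then 1 else 0"] b(1)
    by (auto simp: inj_eq)
  then obtain \<phi> where \<phi>: "\<And>i. functional (\<phi> i)" "\<And>i j. \<phi> i (b j) = (if i = j then 1 else 0)"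
    by metis
  have "p = (\<Sum>i\<in>UNIV. scale_poly (\<phi> i p) (b i))" if "p \<in> sym_power k" for p
    using that unfolding b(3)[symmetric]
  proof (induction rule: poly3.span_induct_alt)
    case base
    then show ?case using \<phi>(1) by (simp add: linear_0)
  next
    case (step c x y)
    then obtain j where j: "x = b j" by blast
    have "\<phi> i (scale_poly c x + y) = (if i = j then c else 0) + \<phi> i y" for i
      using \<phi> by (simp add: j linear_add linear_scale)
    moreover have "(\<Sum>i\<in>UNIV. scale_poly (if i = j then c else 0) (b i)) = scale_poly c (b j)"
      by (simp add: if_distrib[of "\<lambda>c. scale_poly c _"] cong: if_cong)
    ultimately show ?case
      using step.IH by (simp add: poly3.scale_left_distrib sum.distrib j)
  qed
  with \<phi> show thesis by (intro that)
qed

theorem theorem4p1: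
  fixes k :: nat and b :: "'n::finite \<Rightarrow> poly3"
  assumes "k > 0"
    and "CARD('n) = (k + 2) * (k + 1) div 2"
    and "sym_basis k b"
  shows "detects tensor_cube (sym_matrix b ` SL3)"
proof -
  obtain \<phi> where \<phi>: "\<And>i. functional (\<phi> i)"
    and repr: "\<And>p. p \<in> sym_power k \<Longrightarrow> p = (\<Sum>i\<in>UNIV. scale_poly (\<phi> i p) (b i))"
    and dual: "\<And>i j. \<phi> i (b j) = (if i = j then 1 else 0)"
    using sym_basis_dual[OF assms(3)] by blast
  \<comment> \<open>\<open>w\<close> holds the coordinates of \<open>D ^ k\<close> in the basis of
    the tensors of \<open>b i\<close>, \<open>b j\<close>, \<open>b l\<close>.\<close>
  define w :: "complex^('n \<times> 'n \<times> 'n)" where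
    "w = (\<chi> r. det_power_pairing k (\<phi> (fst r)) (\<phi> (fst (snd r))) (\<phi> (snd (snd r))))"
  have triples: "(\<Sum>c\<in>UNIV. F (fst c) (fst (snd c)) (snd (snd c))) =
      (\<Sum>i\<in>UNIV. \<Sum>j\<in>UNIV. \<Sum>l\<in>UNIV. F i j l)" for F :: "'n \<Rightarrow> 'n \<Rightarrow> 'n \<Rightarrow> complex"
    by (simp add: sum.cartesian_product case_prod_unfold)

  have "tensor_cube (sym_matrix b A) *v w = w" if "A \<in> SL3" for A
  proof -
    let ?g = "sym_matrix b A"
    \<comment> \<open>Row \<open>i\<close> of the matrix expresses the pullback of
      \<open>\<phi> i\<close> under the action in the dual basis.\<close>
    have coord: "\<phi> i (sym_action A p) = (\<Sum>j\<in>UNIV. ?g $ i $ j * \<phi> j p)" if "p \<in> sym_power k" for i p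
    proof -
      interpret \<phi>: Vector_Spaces.linear scale_poly "(*)" "\<phi> i" by (rule \<phi>)
      have "sym_action A p = (\<Sum>j\<in>UNIV. scale_poly (\<phi> j p) (\<Sum>l\<in>UNIV. scale_poly (?g $ l $ j) (b l)))"
        by (subst (1) repr[OF that])
           (simp only: sym_action.sum sym_action.scale sym_action_basis[OF assms(3)])
      then show ?thesis
        by (simp add: \<phi>.sum \<phi>.scale dual if_distrib mult.commute cong: if_cong)
    qed
    have "(tensor_cube ?g *v w) $ r = w $ r" for r
    proof -
      have "(tensor_cube ?g *v w) $ r = (\<Sum>i\<in>UNIV. \<Sum>j\<in>UNIV. \<Sum>l\<in>UNIV.
          ?g $ fst r $ i * ?g $ fst (snd r) $ j * ?g $ snd (snd r) $ l *
          det_power_pairing k (\<phi> i) (\<phi> j) (\<phi> l))"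
        by (simp add: matrix_vector_mult_def tensor_cube_def w_def triples[symmetric])
      \<comment> \<open>Trilinearity moves the matrix entries into the three slots, where
        \<open>coord\<close> applies in degree \<open>k\<close>.\<close>
      also have "\<dots> = det_power_pairing k (\<lambda>p. \<phi> (fst r) (sym_action A p))
          (\<lambda>p. \<phi> (fst (snd r)) (sym_action A p)) (\<lambda>p. \<phi> (snd (snd r)) (sym_action A p))"
        unfolding det_power_pairing_sum[symmetric]
        by (intro det_power_pairing_cong coord[symmetric])
      also have "\<dots> = w $ r"
        using that by (simp add: det_power_pairing_sym_action \<phi> w_def SL3_def)
      finally show ?thesis .
    qed
    then show ?thesis by (simp add: vec_eq_iff)
  qed
  then have "(*v) (tensor_cube g) ` vec.span {w} \<subseteq> vec.span {w}" if "g \<in> sym_matrix b ` SL3" for g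
    using that by (auto simp: vec.span_singleton vec.scale)

  moreover have "w \<noteq> 0"
  proof
    assume "w = 0"
    then have 0: "det_power_pairing k (\<phi> i) (\<phi> j) (\<phi> l) = 0" for i j l
      by (auto simp: w_def vec_eq_iff)
    \<comment> \<open>Coefficient extraction is a combination of the \<open>\<phi> i\<close>, so
      vanishing of all coordinates of \<open>w\<close> would make the leading coefficient 0 instead
      of 1.\<close>
    have coeff: "Poly_Mapping.lookup p m = (\<Sum>i\<in>UNIV. Poly_Mapping.lookup (b i) m * \<phi> i p)"
      if "p \<in> sym_power k" for p m
      by (subst (1) repr[OF that]) (simp add: lookup_sum mult.commute)
    have "1 = det_power_pairing k
        (\<lambda>p. \<Sum>i\<in>UNIV. Poly_Mapping.lookup (b i) (Poly_Mapping.single 1 k) * \<phi> i p)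
        (\<lambda>p. \<Sum>i\<in>UNIV. Poly_Mapping.lookup (b i) (Poly_Mapping.single 2 k) * \<phi> i p)
        (\<lambda>p. \<Sum>i\<in>UNIV. Poly_Mapping.lookup (b i) (Poly_Mapping.single 3 k) * \<phi> i p)"
      unfolding det_power_pairing_leading_coeff[of k, symmetric]
      by (intro det_power_pairing_cong coeff)
    then show False by (simp add: det_power_pairing_sum 0)
  qed
  then have "vec.dim (vec.span {w}) = 1"
    by (simp add: vec.dim_eq_card_independent)
  ultimately show ?thesis
    unfolding detects_def by (meson vec.subspace_span)
qed

end
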